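(* Let $X$ and $Y$ be completely regular Hausdorff spaces and let $\mathscr{P},\mathscr{Q}$ be ideals of closed sets in $X$ and $Y$ respectively such that $X_\mathscr{P}$ and $Y_\mathscr{Q}$ are finite sets with $|X_\mathscr{P}|\geq 2$ and $|Y_\mathscr{Q}|\geq 2$. Then the following statements are equivalent: (1) $G(C_\mathscr{P}(X))$ and $G(C_\mathscr{Q}(Y))$ are graph isomorphic. (2) $AG(C_\mathscr{P}(X))$ and $AG(C_\mathscr{Q}(Y))$ are graph isomorphic. (3) $C_\mathscr{P}(X)$ and $C_\mathscr{Q}(Y)$ are ring isomorphic.
   Context: $C(X)$ is the ring of all real valued continuous functions on $X$; $Z(f)=\{x\in X: f(x)=0\}$. An ideal of closed sets in $X$ is a nonempty family $\mathscr{P}$ of closed subsets of $X$ such that $A,B\in\mathscr{P}$ implies $A\cup B\in\mathscr{P}$, and $A\in\mathscr{P}$, $C\subset A$ with $C$ closed in $X$ implies $C\in\mathscr{P}$. $C_\mathscr{P}(X)=\{f\in C(X): cl_X(X\setminus Z(f))\in\mathscr{P}\}$, a commutative ring (possibly without identity). $X_\mathscr{P}$ is the set of all $x\in X$ having an open neighborhood $V$ with $cl_XV\in\mathscr{P}$. For a commutative ring $R$, $Z(R)^*$ is the set of nonzero zero divisors, i.e. nonzero $a\in R$ with $ab=0$ for some nonzero $b\in R$, and $ann(a)=\{r\in R: ra=0\}$. The annihilator graph $AG(R)$ is the simple graph with vertex set $Z(R)^*$ in which distinct $a,b$ are adjacent iff $ann(a)\cup ann(b)\neq ann(ab)$. On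 $C_\mathscr{P}(X)$ define the equivalence relation $f\sim g$ iff $int_XZ(f)\cap X_\mathscr{P}=int_XZ(g)\cap X_\mathscr{P}$. Fix a set $S\subset C_\mathscr{P}(X)$ containing exactly one element of each class, and put $V(C_\mathscr{P}(X))=\{f\in S\setminus\{0\}: int_XZ(f)\cap X_\mathscr{P}\neq\emptyset\}$, a subset of $Z(C_\mathscr{P}(X))^*$. $G(C_\mathscr{P}(X))$ is the induced subgraph of $AG(C_\mathscr{P}(X))$ with vertex set $V(C_\mathscr{P}(X))$. The same definitions apply to $(Y,\mathscr{Q})$. *)

theory Defs
  imports "HOL-Analysis.Analysis"
begin

section \<open>Commutative rings, possibly without identity\<close>

text \<open>The rings of the HOL-Algebra library have an identity, and its ring homomorphisms preserve it;
  here neither is wanted.\<close>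

record 'a rng =
  rng_carrier :: "'a set"
  rng_add :: "'a \<Rightarrow> 'a \<Rightarrow> 'a"
  rng_mult :: "'a \<Rightarrow> 'a \<Rightarrow> 'a"
  rng_zero :: 'a

locale comm_rng =
  fixes R :: "'a rng"
  assumes add_closed: "\<lbrakk>a \<in> rng_carrier R; b \<in> rng_carrier R\<rbrakk> \<Longrightarrow> rng_add R a b \<in> rng_carrier R"
    and mult_closed: "\<lbrakk>a \<in> rng_carrier R; b \<in> rng_carrier R\<rbrakk> \<Longrightarrow> rng_mult R a b \<in> rng_carrier R"
    and zero_closed: "rng_zero R \<in> rng_carrier R"
    and add_assoc: "\<lbrakk>a \<in> rng_carrier R; b \<in> rng_carrier R; c \<in> rng_carrier R\<rbrakk>
      \<Longrightarrow> rng_add R (rng_add R a b) c = rng_add R a (rng_add R b c)"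
    and add_comm: "\<lbrakk>a \<in> rng_carrier R; b \<in> rng_carrier R\<rbrakk> \<Longrightarrow> rng_add R a b = rng_add R b a"
    and add_zero: "a \<in> rng_carrier R \<Longrightarrow> rng_add R a (rng_zero R) = a"
    and add_inverse: "a \<in> rng_carrier R \<Longrightarrow> \<exists>b\<in>rng_carrier R. rng_add R a b = rng_zero R"
    and mult_assoc: "\<lbrakk>a \<in> rng_carrier R; b \<in> rng_carrier R; c \<in> rng_carrier R\<rbrakk>
      \<Longrightarrow> rng_mult R (rng_mult R a b) c = rng_mult R a (rng_mult R b c)"
    and mult_comm: "\<lbrakk>a \<in> rng_carrier R; b \<in> rng_carrier R\<rbrakk> \<Longrightarrow> rng_mult R a b = rng_mult R b a"
    and distrib: "\<lbrakk>a \<in> rng_carrier R; b \<in> rng_carrier R; c \<in> rng_carrier R\<rbrakk>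
      \<Longrightarrow> rng_mult R a (rng_add R b c) = rng_add R (rng_mult R a b) (rng_mult R a c)"

definition rng_isomorphic :: "'a rng \<Rightarrow> 'b rng \<Rightarrow> bool" where
  "rng_isomorphic R R' \<longleftrightarrow>
    (\<exists>h. bij_betw h (rng_carrier R) (rng_carrier R') \<and>
      (\<forall>a\<in>rng_carrier R. \<forall>b\<in>rng_carrier R.
        h (rng_add R a b) = rng_add R' (h a) (h b) \<and>
        h (rng_mult R a b) = rng_mult R' (h a) (h b)))"

definition nonzero_zero_divisors :: "'a rng \<Rightarrow> 'a set" where
  "nonzero_zero_divisors R =
    {a \<in> rng_carrier R. a \<noteq> rng_zero R \<and>
      (\<exists>b\<in>rng_carrier R. b \<noteq> rng_zero R \<and> rng_mult R a b = rng_zero R)}"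

definition ann :: "'a rng \<Rightarrow> 'a \<Rightarrow> 'a set" where
  "ann R a = {r \<in> rng_carrier R. rng_mult R r a = rng_zero R}"

section \<open>Simple graphs\<close>

text \<open>Edges are two-element sets of vertices.\<close>

record 'v sgraph =
  sverts :: "'v set"
  sedges :: "'v set set"

definition induced_sgraph :: "'v sgraph \<Rightarrow> 'v set \<Rightarrow> 'v sgraph" where
  "induced_sgraph G W = \<lparr>sverts = W, sedges = {e \<in> sedges G. e \<subseteq> W}\<rparr>"

definition sgraph_isomorphic :: "'v sgraph \<Rightarrow> 'w sgraph \<Rightarrow> bool" where
  "sgraph_isomorphic G H \<longleftrightarrow>
    (\<exists>\<phi>. bij_betw \<phi> (sverts G) (sverts H) \<and>
      (\<forall>u\<in>sverts G. \<forall>v\<in>sverts G. {u, v} \<in> sedges G \<longleftrightarrow> {\<phi> u, \<phi> v} \<in> sedges H))"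

definition annihilator_graph :: "'a rng \<Rightarrow> 'a sgraph" where
  "annihilator_graph R =
    \<lparr>sverts = nonzero_zero_divisors R,
     sedges = {{a, b} |a b.
       a \<in> nonzero_zero_divisors R \<and> b \<in> nonzero_zero_divisors R \<and> a \<noteq> b \<and>
       ann R a \<union> ann R b \<noteq> ann R (rng_mult R a b)}\<rparr>"

section \<open>The rings \<open>C\<^sub>P(X)\<close>\<close>

text \<open>A function on the space is represented by its extensional representative, so that
  equality of functions is equality on the underlying set of the space.\<close>

definition cont_fun :: "'a topology \<Rightarrow> ('a \<Rightarrow> real) set" where
  "cont_fun X = {f \<in> extensional (topspace X). continuous_map X euclideanreal f}"

definition zero_set :: "'a topology \<Rightarrow> ('a \<Rightarrow> real) \<Rightarrow> 'a set" where
  "zero_set X f = {x \<in> topspace X. f x = 0}"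

definition closed_ideal :: "'a topology \<Rightarrow> 'a set set \<Rightarrow> bool" where
  "closed_ideal X P \<longleftrightarrow>
    P \<noteq> {} \<and> (\<forall>A\<in>P. closedin X A) \<and>
    (\<forall>A\<in>P. \<forall>B\<in>P. A \<union> B \<in> P) \<and>
    (\<forall>A\<in>P. \<forall>C. C \<subseteq> A \<and> closedin X C \<longrightarrow> C \<in> P)"

definition C_ring :: "'a topology \<Rightarrow> 'a set set \<Rightarrow> ('a \<Rightarrow> real) rng" where
  "C_ring X P =
    \<lparr>rng_carrier = {f \<in> cont_fun X. X closure_of (topspace X - zero_set X f) \<in> P},
     rng_add = (\<lambda>f g. \<lambda>x\<in>topspace X. f x + g x),
     rng_mult = (\<lambda>f g. \<lambda>x\<in>topspace X. f x * g x),
     rng_zero = (\<lambda>x\<in>topspace X. 0)\<rparr>"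

definition local_part :: "'a topology \<Rightarrow> 'a set set \<Rightarrow> 'a set" where
  "local_part X P =
    {x \<in> topspace X. \<exists>V. openin X V \<and> x \<in> V \<and> X closure_of V \<in> P}"

definition C_equiv :: "'a topology \<Rightarrow> 'a set set \<Rightarrow> (('a \<Rightarrow> real) \<times> ('a \<Rightarrow> real)) set" where
  "C_equiv X P =
    {(f, g). f \<in> rng_carrier (C_ring X P) \<and> g \<in> rng_carrier (C_ring X P) \<and>
      X interior_of (zero_set X f) \<inter> local_part X P =
      X interior_of (zero_set X g) \<inter> local_part X P}"

definition class_representatives :: "'a topology \<Rightarrow> 'a set set \<Rightarrow> ('a \<Rightarrow> real) set \<Rightarrow> bool" where
  "class_representatives X P S \<longleftrightarrow>
    S \<subseteq> rng_carrier (C_ring X P) \<and>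
    (\<forall>K \<in> rng_carrier (C_ring X P) // C_equiv X P. \<exists>!f. f \<in> S \<and> f \<in> K)"

definition V_set :: "'a topology \<Rightarrow> 'a set set \<Rightarrow> ('a \<Rightarrow> real) set \<Rightarrow> ('a \<Rightarrow> real) set" where
  "V_set X P S =
    {f \<in> S - {rng_zero (C_ring X P)}. X interior_of (zero_set X f) \<inter> local_part X P \<noteq> {}}"

definition G_graph :: "'a topology \<Rightarrow> 'a set set \<Rightarrow> ('a \<Rightarrow> real) set \<Rightarrow> ('a \<Rightarrow> real) sgraph" where
  "G_graph X P S = induced_sgraph (annihilator_graph (C_ring X P)) (V_set X P S)"

lemma equiv_C_equiv: "equiv (rng_carrier (C_ring X P)) (C_equiv X P)"
  unfolding equiv_def refl_on_def sym_def trans_def C_equiv_def by auto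

lemma C_ring_carrier_closed:
  assumes P: "closed_ideal X P"
    and h: "h \<in> cont_fun X" and A: "A \<in> P" and B: "B \<in> P"
    and sub: "topspace X - zero_set X h \<subseteq> A \<union> B"
  shows "h \<in> rng_carrier (C_ring X P)"
proof -
  have 1: "A \<union> B \<in> P"
    using P A B unfolding closed_ideal_def by blast
  have 2: "closedin X (A \<union> B)"
    using P 1 by (simp add: closed_ideal_def)
  have "X closure_of (topspace X - zero_set X h) \<subseteq> A \<union> B"
    using sub 2 by (simp add: closure_of_minimal)
  then have "X closure_of (topspace X - zero_set X h) \<in> P"
    using P 1 unfolding closed_ideal_def by (meson closedin_closure_of)
  then show ?thesis using h by (simp add: C_ring_def)
qed

lemma comm_rng_C_ring:
  assumes P: "closed_ideal X P"
  shows "comm_rng (C_ring X P)"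
proof -
  let ?C = "rng_carrier (C_ring X P)"
  let ?cl = "\<lambda>f. X closure_of (topspace X - zero_set X f)"
  have mem: "f \<in> extensional (topspace X)" "continuous_map X euclideanreal f" "?cl f \<in> P"
    if "f \<in> ?C" for f
    using that by (auto simp: C_ring_def cont_fun_def)
  have nz: "x \<in> ?cl f" if "x \<in> topspace X" "f x \<noteq> 0" for f x
    using that closure_of_subset[of "topspace X - zero_set X f" X]
    by (auto simp: zero_set_def)
  have cong: "(\<lambda>x\<in>topspace X. k x) \<in> cont_fun X" if "continuous_map X euclideanreal k" for k
    using that by (auto simp: cont_fun_def intro: continuous_map_eq)
  have add: "(\<lambda>x\<in>topspace X. f x + g x) \<in> ?C" if "f \<in> ?C" "g \<in> ?C" for f g
  proof (rule C_ring_carrier_closed[OF P _ mem(3)[OF that(1)] mem(3)[OF that(2)]])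
    show "(\<lambda>x\<in>topspace X. f x + g x) \<in> cont_fun X"
      by (intro cong continuous_map_add mem that)
    show "topspace X - zero_set X (\<lambda>x\<in>topspace X. f x + g x) \<subseteq> ?cl f \<union> ?cl g"
    proof
      fix x assume "x \<in> topspace X - zero_set X (\<lambda>x\<in>topspace X. f x + g x)"
      then have "x \<in> topspace X" "f x \<noteq> 0 \<or> g x \<noteq> 0" by (auto simp: zero_set_def)
      then show "x \<in> ?cl f \<union> ?cl g" using nz by blast
    qed
  qed
  have mult: "(\<lambda>x\<in>topspace X. f x * g x) \<in> ?C"
    if "f \<in> ?C" "continuous_map X euclideanreal g" for f g
  proof (rule C_ring_carrier_closed[OF P _ mem(3)[OF that(1)] mem(3)[OF that(1)]])
    show "(\<lambda>x\<in>topspace X. f x * g x) \<in> cont_fun X"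
      by (intro cong continuous_map_real_mult mem that)
    show "topspace X - zero_set X (\<lambda>x\<in>topspace X. f x * g x) \<subseteq> ?cl f \<union> ?cl f"
    proof
      fix x assume "x \<in> topspace X - zero_set X (\<lambda>x\<in>topspace X. f x * g x)"
      then have "x \<in> topspace X" "f x \<noteq> 0" by (auto simp: zero_set_def)
      then show "x \<in> ?cl f \<union> ?cl f" using nz by blast
    qed
  qed
  have zero: "(\<lambda>x\<in>topspace X. 0) \<in> ?C"
  proof -
    obtain A where A: "A \<in> P" using P unfolding closed_ideal_def by auto
    show ?thesis
      by (rule C_ring_carrier_closed[OF P _ A A]) (auto simp: zero_set_def intro!: cong)
  qed
  have inv: "\<exists>g\<in>?C. (\<lambda>x\<in>topspace X. f x + g x) = (\<lambda>x\<in>topspace X. 0)" if "f \<in> ?C" for f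
  proof
    show "(\<lambda>x\<in>topspace X. f x * (- 1)) \<in> ?C" by (rule mult[OF that]) simp
  qed (auto simp: restrict_def)
  have ops: "rng_add (C_ring X P) = (\<lambda>f g. \<lambda>x\<in>topspace X. f x + g x)"
    "rng_mult (C_ring X P) = (\<lambda>f g. \<lambda>x\<in>topspace X. f x * g x)"
    "rng_zero (C_ring X P) = (\<lambda>x\<in>topspace X. 0)"
    by (simp_all add: C_ring_def)
  show ?thesis
  proof (unfold_locales, unfold ops)
    fix f assume f: "f \<in> ?C"
    show "(\<lambda>x\<in>topspace X. f x + (\<lambda>x\<in>topspace X. 0) x) = f"
      using mem(1)[OF f] by (auto simp: extensional_def)
  next
    fix f g assume "f \<in> ?C" "g \<in> ?C"
    then show "(\<lambda>x\<in>topspace X. f x + g x) \<in> ?C" "(\<lambda>x\<in>topspace X. f x * g x) \<in> ?C"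
      by (simp_all only: add mult mem)
  next
    show "(\<lambda>x\<in>topspace X. 0) \<in> ?C" by (rule zero)
  next
    fix f assume "f \<in> ?C"
    then show "\<exists>g\<in>?C. (\<lambda>x\<in>topspace X. f x + g x) = (\<lambda>x\<in>topspace X. 0)" by (rule inv)
  qed (simp_all add: algebra_simps fun_eq_iff restrict_def)
qed

end

theory Submission
  imports Defs
begin

text \<open>
  Let \<open>L = X\<^sub>P\<close> be finite. It is open, and \<open>X\<close> is Hausdorff, so \<open>L\<close> is a discrete clopen set all of
  whose subsets belong to \<open>P\<close>; and a member of \<open>C\<^sub>P(X)\<close> vanishes outside \<open>L\<close>. Hence \<open>C\<^sub>P(X)\<close> consists
  of all functions that vanish off \<open>L\<close> (\<open>mem_carrier_iff\<close>), that is, it is a copy of the ring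
  \<open>\<real>\<^sup>n\<close> with \<open>n = card L\<close>. All three statements turn out to be equivalent to
  \<open>card X\<^sub>P = card Y\<^sub>Q\<close>.

  What the graphs see of a function is its cozero set \<open>A \<subseteq> L\<close>. The vertices of the annihilator graph
  are the functions with \<open>A\<close> proper and nonempty, and two of them are adjacent iff their
  cozero sets are incomparable under inclusion (\<open>edge_iff\<close>): an element killing the product \<open>f g\<close>
  but neither factor is one that vanishes on \<open>A \<inter> B\<close> and meets both \<open>A - B\<close> and \<open>B - A\<close>. The graph
  \<open>G\<close> keeps one function for each \<open>A\<close>, so it has \<open>2\<^sup>n - 2\<close> vertices and determines \<open>n\<close>. The
  annihilator graph is the blow-up of \<open>G\<close> in which every vertex is replaced by infinitely many twins;
  since different cozero sets give different neighbourhoods, the number of distinct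
  neighbourhoods is again \<open>2\<^sup>n - 2\<close> (\<open>card_neighbourhoods\<close>).

  Conversely a bijection between \<open>X\<^sub>P\<close> and \<open>Y\<^sub>Q\<close> transports functions, which is an isomorphism of
  rings and so of annihilator graphs, and it transports cozero sets, which is an isomorphism
  between the graphs \<open>G\<close>.
\<close>

section \<open>Graph and ring isomorphisms\<close>

definition neighbourhood :: "'v sgraph \<Rightarrow> 'v \<Rightarrow> 'v set" where
  "neighbourhood G v = {w \<in> sverts G. {v, w} \<in> sedges G}"

lemma sgraph_isomorphic_card_verts:
  assumes "sgraph_isomorphic G H"
  shows "card (sverts G) = card (sverts H)"
  using assms unfolding sgraph_isomorphic_def by (auto intro: bij_betw_same_card)

text \<open>Counting neighbourhoods instead of vertices identifies twins, which makes the count a useful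
  invariant also of infinite graphs.\<close>

lemma sgraph_isomorphic_card_neighbourhoods:
  assumes "sgraph_isomorphic G H"
  shows "card (neighbourhood G ` sverts G) = card (neighbourhood H ` sverts H)"
proof -
  obtain \<phi> where bij: "bij_betw \<phi> (sverts G) (sverts H)"
    and edges: "\<And>u v. u \<in> sverts G \<Longrightarrow> v \<in> sverts G \<Longrightarrow>
      {u, v} \<in> sedges G \<longleftrightarrow> {\<phi> u, \<phi> v} \<in> sedges H"
    using assms unfolding sgraph_isomorphic_def by blast
  have verts: "sverts H = \<phi> ` sverts G" and inj: "inj_on \<phi> (sverts G)"
    using bij by (auto simp: bij_betw_def)
  have nb: "neighbourhood H (\<phi> u) = \<phi> ` neighbourhood G u" if "u \<in> sverts G" for u
    using that edges by (auto simp: neighbourhood_def verts)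
  have "neighbourhood H ` sverts H = image \<phi> ` (neighbourhood G ` sverts G)"
    unfolding verts image_image by (intro image_cong refl nb)
  moreover have "inj_on (image \<phi>) (neighbourhood G ` sverts G)"
    using inj by (intro inj_on_image) (auto simp: neighbourhood_def intro: inj_on_subset)
  ultimately show ?thesis by (simp add: card_image)
qed

lemma (in comm_rng) add_idem_zero:
  assumes a: "a \<in> rng_carrier R" and aa: "rng_add R a a = a"
  shows "a = rng_zero R"
proof -
  obtain b where b: "b \<in> rng_carrier R" "rng_add R a b = rng_zero R"
    using add_inverse[OF a] by blast
  have "rng_add R (rng_add R a a) b = a"
    using a b by (simp add: add_assoc add_zero)
  then show ?thesis using aa b by simp
qed

lemma (in comm_rng) edge_annihilator_graph_iff:
  assumes a: "a \<in> nonzero_zero_divisors R" and b: "b \<in> nonzero_zero_divisors R"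
  shows "{a, b} \<in> sedges (annihilator_graph R) \<longleftrightarrow>
    a \<noteq> b \<and> ann R a \<union> ann R b \<noteq> ann R (rng_mult R a b)"
proof
  have car: "a \<in> rng_carrier R" "b \<in> rng_carrier R"
    using a b by (simp_all add: nonzero_zero_divisors_def)
  assume "{a, b} \<in> sedges (annihilator_graph R)"
  then obtain c d where cd: "{a, b} = {c, d}" "c \<noteq> d" "ann R c \<union> ann R d \<noteq> ann R (rng_mult R c d)"
    by (auto simp: annihilator_graph_def)
  then consider "c = a" "d = b" | "c = b" "d = a" by (auto simp: doubleton_eq_iff)
  then show "a \<noteq> b \<and> ann R a \<union> ann R b \<noteq> ann R (rng_mult R a b)"
  proof cases
    case 1
    then show ?thesis using cd by simp
  next
    case 2
    then show ?thesis using cd by (simp only: mult_comm[OF car] Un_commute) simp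
  qed
next
  assume "a \<noteq> b \<and> ann R a \<union> ann R b \<noteq> ann R (rng_mult R a b)"
  then show "{a, b} \<in> sedges (annihilator_graph R)"
    using a b unfolding annihilator_graph_def by auto
qed

text \<open>A bijection respecting both operations respects \<open>0\<close>, because \<open>0\<close> is the only additive
  idempotent; so it respects everything defined from annihilators.\<close>

lemma rng_isomorphic_annihilator_graph:
  assumes R: "comm_rng R" and R': "comm_rng R'" and iso: "rng_isomorphic R R'"
  shows "sgraph_isomorphic (annihilator_graph R) (annihilator_graph R')"
proof -
  obtain h where bij: "bij_betw h (rng_carrier R) (rng_carrier R')"
    and add: "\<And>a b. a \<in> rng_carrier R \<Longrightarrow> b \<in> rng_carrier R \<Longrightarrow>
      h (rng_add R a b) = rng_add R' (h a) (h b)"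
    and mult: "\<And>a b. a \<in> rng_carrier R \<Longrightarrow> b \<in> rng_carrier R \<Longrightarrow>
      h (rng_mult R a b) = rng_mult R' (h a) (h b)"
    using iso unfolding rng_isomorphic_def by blast
  interpret R: comm_rng R by (rule R)
  interpret R': comm_rng R' by (rule R')
  have inj: "inj_on h (rng_carrier R)" and img: "rng_carrier R' = h ` rng_carrier R"
    using bij by (auto simp: bij_betw_def)
  have mem: "h a \<in> rng_carrier R'" if "a \<in> rng_carrier R" for a
    using that img by blast
  have zero: "h (rng_zero R) = rng_zero R'"
  proof (rule R'.add_idem_zero)
    show "rng_add R' (h (rng_zero R)) (h (rng_zero R)) = h (rng_zero R)"
      using add[OF R.zero_closed R.zero_closed] R.add_zero[OF R.zero_closed] by simp
  qed (rule mem[OF R.zero_closed])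
  have zero_iff: "h a = rng_zero R' \<longleftrightarrow> a = rng_zero R" if "a \<in> rng_carrier R" for a
    using inj that R.zero_closed by (metis zero inj_on_eq_iff)
  have mult_zero_iff: "rng_mult R' (h a) (h b) = rng_zero R' \<longleftrightarrow> rng_mult R a b = rng_zero R"
    if "a \<in> rng_carrier R" "b \<in> rng_carrier R" for a b
    using that by (simp add: mult[symmetric] zero_iff R.mult_closed)
  have nzd_iff: "h a \<in> nonzero_zero_divisors R' \<longleftrightarrow> a \<in> nonzero_zero_divisors R"
    if "a \<in> rng_carrier R" for a
    using that by (auto simp: nonzero_zero_divisors_def img zero_iff mult_zero_iff)
  have nzd_sub: "nonzero_zero_divisors R \<subseteq> rng_carrier R"
    by (auto simp: nonzero_zero_divisors_def)
  have nzd_img: "nonzero_zero_divisors R' = h ` nonzero_zero_divisors R"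
  proof
    show "nonzero_zero_divisors R' \<subseteq> h ` nonzero_zero_divisors R"
    proof
      fix b assume b: "b \<in> nonzero_zero_divisors R'"
      then have "b \<in> rng_carrier R'" by (simp add: nonzero_zero_divisors_def)
      then obtain a where "a \<in> rng_carrier R" "b = h a" by (auto simp: img)
      then show "b \<in> h ` nonzero_zero_divisors R" using b nzd_iff by blast
    qed
    show "h ` nonzero_zero_divisors R \<subseteq> nonzero_zero_divisors R'"
      using nzd_iff nzd_sub by blast
  qed
  have ann_img: "ann R' (h a) = h ` ann R a" if "a \<in> rng_carrier R" for a
    using that by (auto simp: ann_def img mult_zero_iff)
  have ann_sub: "ann R a \<subseteq> rng_carrier R" for a
    by (auto simp: ann_def)
  have edge: "{a, b} \<in> sedges (annihilator_graph R) \<longleftrightarrow>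
      {h a, h b} \<in> sedges (annihilator_graph R')"
    if "a \<in> nonzero_zero_divisors R" "b \<in> nonzero_zero_divisors R" for a b
  proof -
    have ab: "a \<in> rng_carrier R" "b \<in> rng_carrier R" using that nzd_sub by blast+
    have "ann R' (h a) \<union> ann R' (h b) = ann R' (rng_mult R' (h a) (h b)) \<longleftrightarrow>
        h ` (ann R a \<union> ann R b) = h ` ann R (rng_mult R a b)"
      using ab by (simp add: mult[symmetric] ann_img R.mult_closed image_Un)
    also have "\<dots> \<longleftrightarrow> ann R a \<union> ann R b = ann R (rng_mult R a b)"
      using inj ann_sub by (intro inj_on_image_eq_iff) auto
    finally have 1: "ann R' (h a) \<union> ann R' (h b) = ann R' (rng_mult R' (h a) (h b)) \<longleftrightarrow>
      ann R a \<union> ann R b = ann R (rng_mult R a b)" .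
    have 2: "h a = h b \<longleftrightarrow> a = b" using inj ab by (simp add: inj_on_eq_iff)
    have 3: "h a \<in> nonzero_zero_divisors R'" "h b \<in> nonzero_zero_divisors R'"
      using that by (auto simp: nzd_img)
    show ?thesis
      by (simp only: R.edge_annihilator_graph_iff[OF that] R'.edge_annihilator_graph_iff[OF 3] 1 2)
  qed
  show ?thesis unfolding sgraph_isomorphic_def
  proof (intro exI conjI ballI)
    show "bij_betw h (sverts (annihilator_graph R)) (sverts (annihilator_graph R'))"
      using inj_on_subset[OF inj nzd_sub] by (simp add: annihilator_graph_def bij_betw_def nzd_img)
    show "{a, b} \<in> sedges (annihilator_graph R) \<longleftrightarrow>
        {h a, h b} \<in> sedges (annihilator_graph R')"
      if "a \<in> sverts (annihilator_graph R)" "b \<in> sverts (annihilator_graph R)" for a b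
      using that edge by (simp add: annihilator_graph_def)
  qed
qed

section \<open>Proper nonempty subsets\<close>

definition proper_parts :: "'a set \<Rightarrow> 'a set set" where
  "proper_parts L = {A. A \<subseteq> L \<and> A \<noteq> {} \<and> A \<noteq> L}"

lemma card_proper_parts:
  assumes "finite L" "L \<noteq> {}"
  shows "card (proper_parts L) = 2 ^ card L - 2"
proof -
  have "proper_parts L = Pow L - {{}, L}"
    by (auto simp: proper_parts_def)
  moreover have "card (Pow L - {{}, L}) = card (Pow L) - card {{}, L}"
    by (rule card_Diff_subset) auto
  ultimately show ?thesis using assms by (simp add: card_Pow)
qed

lemma card_eq_from_proper_parts:
  assumes "finite L" "L \<noteq> {}" "finite M" "M \<noteq> {}"
    and "card (proper_parts L) = card (proper_parts M)"
  shows "card L = card M"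
proof -
  have two: "2 \<le> (2::nat) ^ card N" if "finite N" "N \<noteq> {}" for N :: "'c set"
  proof -
    have "(2::nat) ^ 1 \<le> 2 ^ card N"
      using that by (intro power_increasing) (auto simp: Suc_le_eq card_gt_0_iff)
    then show ?thesis by simp
  qed
  have "(2::nat) ^ card L - 2 = 2 ^ card M - 2"
    using assms by (simp add: card_proper_parts)
  then have "(2::nat) ^ card L = 2 ^ card M"
    using two[of L] two[of M] assms
    by (metis le_add_diff_inverse)
  then show ?thesis by simp
qed

lemma bij_betw_proper_parts:
  assumes "bij_betw \<sigma> L M"
  shows "bij_betw (image \<sigma>) (proper_parts L) (proper_parts M)"
proof -
  have PP: "proper_parts N = Pow N - {{}, N}" for N :: "'c set"
    by (auto simp: proper_parts_def)
  have "bij_betw (image \<sigma>) (Pow L) (Pow M)"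
    using assms by (rule bij_betw_Pow)
  moreover have "bij_betw (image \<sigma>) {{}, L} {{}, M}"
    using assms by (auto simp: bij_betw_def inj_on_def)
  ultimately show ?thesis unfolding PP
    by (intro bij_betw_DiffI) auto
qed

section \<open>The ring when the local part is finite\<close>

definition cozero :: "'a topology \<Rightarrow> ('a \<Rightarrow> real) \<Rightarrow> 'a set" where
  "cozero X f = topspace X - zero_set X f"

definition char_fun :: "'a topology \<Rightarrow> 'a set \<Rightarrow> 'a \<Rightarrow> real" where
  "char_fun X A = (\<lambda>x\<in>topspace X. of_bool (x \<in> A))"

lemma mem_cozero_iff: "x \<in> cozero X f \<longleftrightarrow> x \<in> topspace X \<and> f x \<noteq> 0"
  by (auto simp: cozero_def zero_set_def)

lemma cozero_mult: "cozero X (rng_mult (C_ring X P) f g) = cozero X f \<inter> cozero X g"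
  by (auto simp: mem_cozero_iff C_ring_def)

lemma cozero_char_fun: "A \<subseteq> topspace X \<Longrightarrow> cozero X (char_fun X A) = A"
  by (auto simp: mem_cozero_iff char_fun_def)

locale finite_local_part =
  fixes X :: "'a topology" and P :: "'a set set"
  assumes Hausdorff: "Hausdorff_space X"
    and ideal: "closed_ideal X P"
    and finite_local: "finite (local_part X P)"
begin

abbreviation L where "L \<equiv> local_part X P"
abbreviation R where "R \<equiv> C_ring X P"

lemma local_sub: "L \<subseteq> topspace X"
  by (auto simp: local_part_def)

lemma open_in_local:
  assumes "openin X V" "X closure_of V \<in> P"
  shows "V \<subseteq> L"
  using assms openin_subset[OF assms(1)] by (auto simp: local_part_def)

lemma sub_local_closed:
  assumes "A \<subseteq> L" shows "closedin X A"
  using assms local_sub finite_local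
  by (meson Hausdorff Hausdorff_imp_t1_space finite_subset subset_trans t1_space_closedin_finite)

lemma sub_local_open:
  assumes "A \<subseteq> L" shows "openin X A"
proof -
  have "openin X L"
    unfolding openin_subopen[of X L]
  proof
    fix x assume "x \<in> L"
    then obtain V where "openin X V" "x \<in> V" "X closure_of V \<in> P"
      by (auto simp: local_part_def)
    then show "\<exists>V. openin X V \<and> x \<in> V \<and> V \<subseteq> L" using open_in_local by blast
  qed
  moreover have "closedin X (L - A)" by (rule sub_local_closed) auto
  ultimately have "openin X (L - (L - A))" by (rule openin_diff)
  then show ?thesis using assms by (simp add: double_diff)
qed

lemma sub_local_mem:
  assumes "A \<subseteq> L" shows "A \<in> P"
proof -
  have "finite A" using assms finite_local by (rule finite_subset)
  then show ?thesis using assms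
  proof (induction A)
    case empty
    obtain B where "B \<in> P" using ideal by (auto simp: closed_ideal_def)
    then show ?case using ideal unfolding closed_ideal_def
      by (meson closedin_empty empty_subsetI)
  next
    case (insert x A)
    then obtain V where V: "openin X V" "x \<in> V" "X closure_of V \<in> P"
      by (auto simp: local_part_def)
    have "{x} \<subseteq> X closure_of V"
      using V closure_of_subset[OF openin_subset[OF V(1)]] by blast
    moreover have "closedin X {x}" using insert.prems by (intro sub_local_closed) auto
    ultimately have "{x} \<in> P" using V(3) ideal unfolding closed_ideal_def by meson
    moreover have "A \<in> P" using insert by simp
    ultimately have "{x} \<union> A \<in> P" using ideal unfolding closed_ideal_def by meson
    then show ?case by simp
  qed
qed

text \<open>Every function that vanishes off \<open>L\<close> is continuous, since \<open>L\<close> is discrete and clopen.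
  Conversely the cozero set of a member is open with closure in \<open>P\<close>, and this is what makes its
  points belong to \<open>L\<close>.\<close>

lemma mem_carrier_iff:
  "f \<in> rng_carrier R \<longleftrightarrow> f \<in> extensional (topspace X) \<and> cozero X f \<subseteq> L"
proof
  assume f: "f \<in> rng_carrier R"
  then have ext: "f \<in> extensional (topspace X)" and cont: "continuous_map X euclideanreal f"
    and cl: "X closure_of cozero X f \<in> P"
    by (auto simp: C_ring_def cont_fun_def cozero_def)
  have "openin X {x \<in> topspace X. f x \<in> - {0}}"
    using cont by (rule openin_continuous_map_preimage) (simp add: open_Compl)
  moreover have "{x \<in> topspace X. f x \<in> - {0}} = cozero X f"
    by (auto simp: mem_cozero_iff)
  ultimately show "f \<in> extensional (topspace X) \<and> cozero X f \<subseteq> L"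
    using ext cl open_in_local by simp
next
  assume f: "f \<in> extensional (topspace X) \<and> cozero X f \<subseteq> L"
  have "continuous_map X euclideanreal f"
    unfolding continuous_map
  proof (intro conjI allI impI)
    fix U :: "real set"
    have A: "cozero X f \<inter> {x. f x \<in> U} \<subseteq> L" and B: "cozero X f \<inter> {x. f x \<notin> U} \<subseteq> L"
      using f by auto
    show "openin X {x \<in> topspace X. f x \<in> U}"
    proof (cases "0 \<in> U")
      case True
      then have "{x \<in> topspace X. f x \<in> U} = topspace X - (cozero X f \<inter> {x. f x \<notin> U})"
        by (auto simp: mem_cozero_iff)
      then show ?thesis using sub_local_closed[OF B] by (simp add: openin_diff)
    next
      case False
      then have "{x \<in> topspace X. f x \<in> U} = cozero X f \<inter> {x. f x \<in> U}"
        by (auto simp: mem_cozero_iff)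
      then show ?thesis using sub_local_open[OF A] by simp
    qed
  qed auto
  moreover have "X closure_of cozero X f \<in> P"
    using f sub_local_closed sub_local_mem by (simp add: closure_of_closedin)
  ultimately show "f \<in> rng_carrier R"
    using f by (simp add: C_ring_def cont_fun_def cozero_def)
qed

lemma cozero_sub: "f \<in> rng_carrier R \<Longrightarrow> cozero X f \<subseteq> L"
  by (simp add: mem_carrier_iff)

lemma char_fun_mem: "A \<subseteq> L \<Longrightarrow> char_fun X A \<in> rng_carrier R"
  using local_sub by (simp add: mem_carrier_iff cozero_char_fun) (simp add: char_fun_def)

lemma cozero_char_fun_local: "A \<subseteq> L \<Longrightarrow> cozero X (char_fun X A) = A"
  using local_sub by (intro cozero_char_fun) auto

lemma eq_zero_iff:
  assumes "f \<in> extensional (topspace X)"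
  shows "f = rng_zero R \<longleftrightarrow> cozero X f = {}"
proof
  assume "cozero X f = {}"
  then have "f x = 0" if "x \<in> topspace X" for x
    using that by (auto simp: cozero_def zero_set_def)
  then show "f = rng_zero R" using assms by (auto simp: C_ring_def extensional_def)
qed (auto simp: C_ring_def mem_cozero_iff)

lemma mult_eq_zero_iff: "rng_mult R f g = rng_zero R \<longleftrightarrow> cozero X f \<inter> cozero X g = {}"
proof -
  have "rng_mult R f g \<in> extensional (topspace X)" by (simp add: C_ring_def)
  then show ?thesis by (simp only: eq_zero_iff cozero_mult)
qed

section \<open>The annihilator graph and the graph of representatives\<close>

lemma mem_nonzero_zero_divisors_iff:
  "f \<in> nonzero_zero_divisors R \<longleftrightarrow> f \<in> rng_carrier R \<and> cozero X f \<in> proper_parts L"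
proof (cases "f \<in> rng_carrier R")
  case f: True
  have "(\<exists>g\<in>rng_carrier R. g \<noteq> rng_zero R \<and> rng_mult R f g = rng_zero R) \<longleftrightarrow> cozero X f \<noteq> L"
    (is "?ex \<longleftrightarrow> _")
  proof
    assume ?ex
    then obtain g where g: "g \<in> rng_carrier R" "g \<noteq> rng_zero R" "cozero X f \<inter> cozero X g = {}"
      by (auto simp: mult_eq_zero_iff)
    then have "cozero X g \<noteq> {}" using eq_zero_iff[of g] by (simp add: mem_carrier_iff)
    then show "cozero X f \<noteq> L" using g cozero_sub by blast
  next
    assume "cozero X f \<noteq> L"
    then have "L - cozero X f \<noteq> {}" using cozero_sub[OF f] by blast
    then have "char_fun X (L - cozero X f) \<noteq> rng_zero R"
      using cozero_char_fun_local[of "L - cozero X f"] char_fun_mem[of "L - cozero X f"]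
      by (subst eq_zero_iff) (auto simp: mem_carrier_iff)
    then show ?ex
      using char_fun_mem[of "L - cozero X f"] cozero_char_fun_local[of "L - cozero X f"]
      by (intro bexI[of _ "char_fun X (L - cozero X f)"]) (auto simp: mult_eq_zero_iff)
  qed
  then show ?thesis
    using f eq_zero_iff[of f]
    by (auto simp: nonzero_zero_divisors_def proper_parts_def mem_carrier_iff)
qed (simp add: nonzero_zero_divisors_def)

text \<open>The annihilator of the product is larger than the union of the annihilators iff some \<open>C \<subseteq> L\<close>
  misses \<open>A \<inter> B\<close> but meets both \<open>A\<close> and \<open>B\<close>. The largest candidate is \<open>C = L - A \<inter> B\<close>, and it works
  iff neither of \<open>A\<close>, \<open>B\<close> contains the other.\<close>

lemma ann_Un_ne_iff:
  assumes "f \<in> rng_carrier R" "g \<in> rng_carrier R"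
  shows "ann R f \<union> ann R g \<noteq> ann R (rng_mult R f g) \<longleftrightarrow>
    \<not> cozero X f \<subseteq> cozero X g \<and> \<not> cozero X g \<subseteq> cozero X f"
proof -
  let ?A = "cozero X f" and ?B = "cozero X g"
  have ann_eq: "ann R k = {r \<in> rng_carrier R. cozero X r \<inter> cozero X k = {}}" for k
    by (simp add: ann_def mult_eq_zero_iff)
  let ?r = "char_fun X (L - ?A \<inter> ?B)"
  have r: "?r \<in> rng_carrier R" "cozero X ?r = L - ?A \<inter> ?B"
    by (simp_all add: char_fun_mem cozero_char_fun_local Diff_subset)
  show ?thesis
  proof
    assume ne: "ann R f \<union> ann R g \<noteq> ann R (rng_mult R f g)"
    show "\<not> ?A \<subseteq> ?B \<and> \<not> ?B \<subseteq> ?A"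
    proof (rule ccontr)
      assume "\<not> (\<not> ?A \<subseteq> ?B \<and> \<not> ?B \<subseteq> ?A)"
      then have "?A \<inter> ?B = ?A \<or> ?A \<inter> ?B = ?B" by blast
      then have "ann R f \<union> ann R g = ann R (rng_mult R f g)"
        unfolding ann_eq cozero_mult by blast
      then show False using ne by contradiction
    qed
  next
    assume inc: "\<not> ?A \<subseteq> ?B \<and> \<not> ?B \<subseteq> ?A"
    then have "?r \<notin> ann R f \<union> ann R g"
      using r(2) cozero_sub assms unfolding ann_eq by blast
    moreover have "?r \<in> ann R (rng_mult R f g)"
      unfolding ann_eq cozero_mult using r by auto
    ultimately show "ann R f \<union> ann R g \<noteq> ann R (rng_mult R f g)" by metis
  qed
qed

lemma edge_iff:
  assumes f: "f \<in> nonzero_zero_divisors R" and g: "g \<in> nonzero_zero_divisors R"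
  shows "{f, g} \<in> sedges (annihilator_graph R) \<longleftrightarrow>
    \<not> cozero X f \<subseteq> cozero X g \<and> \<not> cozero X g \<subseteq> cozero X f"
proof -
  have car: "f \<in> rng_carrier R" "g \<in> rng_carrier R"
    using f g by (simp_all add: mem_nonzero_zero_divisors_iff)
  show ?thesis
    unfolding comm_rng.edge_annihilator_graph_iff[OF comm_rng_C_ring[OF ideal] f g] ann_Un_ne_iff[OF car]
    by auto
qed

lemma char_fun_vertex:
  assumes "A \<in> proper_parts L"
  shows "char_fun X A \<in> nonzero_zero_divisors R" "cozero X (char_fun X A) = A"
proof -
  have "A \<subseteq> L" using assms by (simp add: proper_parts_def)
  then show "cozero X (char_fun X A) = A" by (rule cozero_char_fun_local)
  with \<open>A \<subseteq> L\<close> show "char_fun X A \<in> nonzero_zero_divisors R"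
    using assms by (simp add: mem_nonzero_zero_divisors_iff char_fun_mem)
qed

text \<open>The neighbours with a one-point cozero set recover \<open>A\<close>: the singleton \<open>{x}\<close> is incomparable
  to a nonempty \<open>A\<close> iff \<open>x \<notin> A\<close>.\<close>

lemma neighbourhood_eq_iff:
  assumes f: "f \<in> nonzero_zero_divisors R" and g: "g \<in> nonzero_zero_divisors R"
  shows "neighbourhood (annihilator_graph R) f = neighbourhood (annihilator_graph R) g \<longleftrightarrow>
    cozero X f = cozero X g"
proof -
  have verts: "sverts (annihilator_graph R) = nonzero_zero_divisors R"
    by (simp add: annihilator_graph_def)
  have nb: "neighbourhood (annihilator_graph R) h = {k \<in> nonzero_zero_divisors R.
      \<not> cozero X h \<subseteq> cozero X k \<and> \<not> cozero X k \<subseteq> cozero X h}"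
    if "h \<in> nonzero_zero_divisors R" for h
    using edge_iff[OF that] by (auto simp: neighbourhood_def verts)
  have sub: "cozero X h \<subseteq> cozero X k"
    if h: "h \<in> nonzero_zero_divisors R" and k: "k \<in> nonzero_zero_divisors R"
      and eq: "neighbourhood (annihilator_graph R) h = neighbourhood (annihilator_graph R) k" for h k
  proof
    fix x assume x: "x \<in> cozero X h"
    have pp: "cozero X h \<in> proper_parts L" "cozero X k \<in> proper_parts L"
      using h k by (simp_all add: mem_nonzero_zero_divisors_iff)
    have "{x} \<in> proper_parts L"
      using x pp(1) unfolding proper_parts_def by auto
    note s = char_fun_vertex[OF this]
    show "x \<in> cozero X k"
    proof (rule ccontr)
      assume "x \<notin> cozero X k"
      then have "char_fun X {x} \<in> neighbourhood (annihilator_graph R) k"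
        using s pp(2) unfolding nb[OF k] proper_parts_def by auto
      then have "char_fun X {x} \<in> neighbourhood (annihilator_graph R) h" by (simp add: eq)
      then show False using s(2) x by (auto simp: nb[OF h])
    qed
  qed
  show ?thesis
  proof
    assume "cozero X f = cozero X g"
    then show "neighbourhood (annihilator_graph R) f = neighbourhood (annihilator_graph R) g"
      unfolding nb[OF f] nb[OF g] by simp
  next
    assume "neighbourhood (annihilator_graph R) f = neighbourhood (annihilator_graph R) g"
    then show "cozero X f = cozero X g"
      using sub[OF f g] sub[OF g f] by simp
  qed
qed

lemma card_neighbourhoods:
  "card (neighbourhood (annihilator_graph R) ` sverts (annihilator_graph R)) =
    card (proper_parts L)"
proof -
  let ?nb = "neighbourhood (annihilator_graph R)"
  have "?nb ` nonzero_zero_divisors R = (\<lambda>A. ?nb (char_fun X A)) ` proper_parts L"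
  proof
    show "?nb ` nonzero_zero_divisors R \<subseteq> (\<lambda>A. ?nb (char_fun X A)) ` proper_parts L"
    proof
      fix N assume "N \<in> ?nb ` nonzero_zero_divisors R"
      then obtain f where f: "f \<in> nonzero_zero_divisors R" "N = ?nb f" by blast
      then have A: "cozero X f \<in> proper_parts L" by (simp add: mem_nonzero_zero_divisors_iff)
      have "N = ?nb (char_fun X (cozero X f))"
        using neighbourhood_eq_iff[OF f(1) char_fun_vertex(1)[OF A]] char_fun_vertex(2)[OF A] f(2)
        by simp
      then show "N \<in> (\<lambda>A. ?nb (char_fun X A)) ` proper_parts L" using A by blast
    qed
    show "(\<lambda>A. ?nb (char_fun X A)) ` proper_parts L \<subseteq> ?nb ` nonzero_zero_divisors R"
      using char_fun_vertex(1) by blast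
  qed
  moreover have "inj_on (\<lambda>A. ?nb (char_fun X A)) (proper_parts L)"
    by (rule inj_onI) (metis char_fun_vertex neighbourhood_eq_iff)
  ultimately show ?thesis by (simp add: annihilator_graph_def card_image)
qed

text \<open>The zero set of a member is open already, because its complement is a closed part of \<open>L\<close>; so
  the relation defining the classes only compares cozero sets.\<close>

lemma interior_zero_set:
  assumes "f \<in> rng_carrier R"
  shows "X interior_of (zero_set X f) \<inter> L = L - cozero X f"
proof -
  have "zero_set X f = topspace X - cozero X f"
    by (auto simp: cozero_def zero_set_def)
  then have "openin X (zero_set X f)"
    using sub_local_closed[OF cozero_sub[OF assms]] by (simp add: openin_diff)
  then show ?thesis
    using local_sub by (auto simp: interior_of_openin cozero_def)
qed

lemma C_equiv_iff:
  "(f, g) \<in> C_equiv X P \<longleftrightarrow>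
    f \<in> rng_carrier R \<and> g \<in> rng_carrier R \<and> cozero X f = cozero X g"
  using interior_zero_set cozero_sub unfolding C_equiv_def by blast

lemma mem_V_set_iff:
  assumes "S \<subseteq> rng_carrier R"
  shows "f \<in> V_set X P S \<longleftrightarrow> f \<in> S \<and> cozero X f \<in> proper_parts L"
proof (cases "f \<in> S")
  case True
  then have f: "f \<in> rng_carrier R" using assms by blast
  then show ?thesis
    using True interior_zero_set[OF f] cozero_sub[OF f] eq_zero_iff[of f]
    by (auto simp: V_set_def proper_parts_def mem_carrier_iff)
qed (simp add: V_set_def)

lemma bij_betw_cozero_V_set:
  assumes S: "class_representatives X P S"
  shows "bij_betw (cozero X) (V_set X P S) (proper_parts L)"
proof -
  have sub: "S \<subseteq> rng_carrier R"
    and rep: "\<And>K. K \<in> rng_carrier R // C_equiv X P \<Longrightarrow> \<exists>!f. f \<in> S \<and> f \<in> K"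
    using S by (auto simp: class_representatives_def)
  have rep_unique: "\<exists>!g. g \<in> S \<and> cozero X g = cozero X f" if "f \<in> rng_carrier R" for f
  proof -
    have "\<exists>!g. g \<in> S \<and> g \<in> C_equiv X P `` {f}"
      by (rule rep[OF quotientI[OF that]])
    moreover have "g \<in> S \<and> g \<in> C_equiv X P `` {f} \<longleftrightarrow> g \<in> S \<and> cozero X g = cozero X f" for g
      using that sub by (auto simp: C_equiv_iff)
    ultimately show ?thesis by simp
  qed
  have "inj_on (cozero X) (V_set X P S)"
  proof (rule inj_onI)
    fix f g assume "f \<in> V_set X P S" "g \<in> V_set X P S" "cozero X f = cozero X g"
    then show "f = g" using rep_unique[of f] sub by (auto simp: mem_V_set_iff[OF sub])
  qed
  moreover have "cozero X ` V_set X P S = proper_parts L"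
  proof
    show "proper_parts L \<subseteq> cozero X ` V_set X P S"
    proof
      fix A assume A: "A \<in> proper_parts L"
      then have "A \<subseteq> L" by (simp add: proper_parts_def)
      then obtain g where "g \<in> S" "cozero X g = A"
        using rep_unique[OF char_fun_mem] cozero_char_fun_local by metis
      then show "A \<in> cozero X ` V_set X P S"
        using A by (auto simp: mem_V_set_iff[OF sub])
    qed
  qed (auto simp: mem_V_set_iff[OF sub])
  ultimately show ?thesis by (simp add: bij_betw_def)
qed

lemma verts_G_graph: "sverts (G_graph X P S) = V_set X P S"
  by (simp add: G_graph_def induced_sgraph_def)

lemma card_verts_G_graph:
  assumes "class_representatives X P S"
  shows "card (sverts (G_graph X P S)) = card (proper_parts L)"
  using bij_betw_same_card[OF bij_betw_cozero_V_set[OF assms]] by (simp add: verts_G_graph)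

lemma edge_G_graph_iff:
  assumes S: "class_representatives X P S" and fg: "f \<in> V_set X P S" "g \<in> V_set X P S"
  shows "{f, g} \<in> sedges (G_graph X P S) \<longleftrightarrow>
    \<not> cozero X f \<subseteq> cozero X g \<and> \<not> cozero X g \<subseteq> cozero X f"
proof -
  have sub: "S \<subseteq> rng_carrier R" using S by (simp add: class_representatives_def)
  have "f \<in> nonzero_zero_divisors R" "g \<in> nonzero_zero_divisors R"
    using fg sub by (auto simp: mem_V_set_iff[OF sub] mem_nonzero_zero_divisors_iff)
  then show ?thesis
    using fg by (simp add: G_graph_def induced_sgraph_def edge_iff)
qed

end

section \<open>Transport along a bijection of the local parts\<close>

text \<open>Relabelling by \<open>\<sigma>\<close> and extending by \<open>0\<close> always gives a member, since continuity and the condition on the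
  support impose nothing on a function that vanishes off the local part.\<close>

lemma rng_isomorphic_of_bij:
  assumes "finite_local_part X P" "finite_local_part Y Q"
    and bij: "bij_betw \<sigma> (local_part X P) (local_part Y Q)"
  shows "rng_isomorphic (C_ring X P) (C_ring Y Q)"
proof -
  interpret X: finite_local_part X P by fact
  interpret Y: finite_local_part Y Q by fact
  define \<tau> where "\<tau> = inv_into X.L \<sigma>"
  have \<tau>: "\<tau> y \<in> X.L" "\<sigma> (\<tau> y) = y" if "y \<in> Y.L" for y
    using bij that unfolding \<tau>_def
    by (auto simp: bij_betw_def inv_into_into f_inv_into_f)
  have \<sigma>: "\<sigma> x \<in> Y.L" "\<tau> (\<sigma> x) = x" if "x \<in> X.L" for x
    using bij that unfolding \<tau>_def by (auto simp: bij_betw_def)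
  define h where "h f = (\<lambda>y\<in>topspace Y. if y \<in> Y.L then f (\<tau> y) else 0)" for f :: "'a \<Rightarrow> real"
  define k where "k g = (\<lambda>x\<in>topspace X. if x \<in> X.L then g (\<sigma> x) else 0)" for g :: "'b \<Rightarrow> real"
  have tX: "x \<in> topspace X" if "x \<in> X.L" for x using X.local_sub that by blast
  have tY: "y \<in> topspace Y" if "y \<in> Y.L" for y using Y.local_sub that by blast
  have offX: "f x = 0" if "f \<in> rng_carrier X.R" "x \<in> topspace X" "x \<notin> X.L" for f x
    using X.cozero_sub[OF that(1)] that by (auto simp: mem_cozero_iff)
  have offY: "g y = 0" if "g \<in> rng_carrier Y.R" "y \<in> topspace Y" "y \<notin> Y.L" for g y
    using Y.cozero_sub[OF that(1)] that by (auto simp: mem_cozero_iff)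
  have h_mem: "h f \<in> rng_carrier Y.R" for f
    by (auto simp: Y.mem_carrier_iff mem_cozero_iff h_def split: if_splits)
  have k_mem: "k g \<in> rng_carrier X.R" for g
    by (auto simp: X.mem_carrier_iff mem_cozero_iff k_def split: if_splits)
  have kh: "k (h f) = f" if "f \<in> rng_carrier X.R" for f
  proof (rule extensionalityI[of _ "topspace X"])
    show "f \<in> extensional (topspace X)" using that by (simp add: X.mem_carrier_iff)
    show "k (h f) x = f x" if "x \<in> topspace X" for x
      using that offX[OF \<open>f \<in> rng_carrier X.R\<close>] \<sigma> tY by (auto simp: k_def h_def)
  qed (simp add: k_def)
  have hk: "h (k g) = g" if "g \<in> rng_carrier Y.R" for g
  proof (rule extensionalityI[of _ "topspace Y"])
    show "g \<in> extensional (topspace Y)" using that by (simp add: Y.mem_carrier_iff)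
    show "h (k g) y = g y" if "y \<in> topspace Y" for y
      using that offY[OF \<open>g \<in> rng_carrier Y.R\<close>] \<tau> tX by (auto simp: k_def h_def)
  qed (simp add: h_def)
  show ?thesis unfolding rng_isomorphic_def
  proof (intro exI conjI ballI)
    show "bij_betw h (rng_carrier X.R) (rng_carrier Y.R)"
      by (rule bij_betw_byWitness[where f' = k]) (auto simp: kh hk h_mem k_mem)
  next
    fix f g
    show "h (rng_add X.R f g) = rng_add Y.R (h f) (h g)"
      using \<tau>(1) tX by (auto simp: h_def C_ring_def fun_eq_iff)
    show "h (rng_mult X.R f g) = rng_mult Y.R (h f) (h g)"
      using \<tau>(1) tX by (auto simp: h_def C_ring_def fun_eq_iff)
  qed
qed

text \<open>The chosen representatives need not correspond under the ring isomorphism, so the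
  vertices are matched through their cozero sets.\<close>

lemma G_graph_isomorphic_of_bij:
  assumes "finite_local_part X P" "finite_local_part Y Q"
    and bij: "bij_betw \<sigma> (local_part X P) (local_part Y Q)"
    and S: "class_representatives X P S" and T: "class_representatives Y Q T"
  shows "sgraph_isomorphic (G_graph X P S) (G_graph Y Q T)"
proof -
  interpret X: finite_local_part X P by fact
  interpret Y: finite_local_part Y Q by fact
  note bX = X.bij_betw_cozero_V_set[OF S] and bY = Y.bij_betw_cozero_V_set[OF T]
  note b\<sigma> = bij_betw_proper_parts[OF bij]
  define \<phi> where "\<phi> = inv_into (V_set Y Q T) (cozero Y) \<circ> (image \<sigma> \<circ> cozero X)"
  have b\<phi>: "bij_betw \<phi> (V_set X P S) (V_set Y Q T)"
    unfolding \<phi>_def by (rule bij_betw_trans[OF bij_betw_trans[OF bX b\<sigma>] bij_betw_inv_into[OF bY]])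
  have coz: "cozero Y (\<phi> f) = \<sigma> ` cozero X f" if "f \<in> V_set X P S" for f
  proof -
    have "\<sigma> ` cozero X f \<in> proper_parts Y.L"
      using that bX b\<sigma> by (auto simp: bij_betw_def)
    then show ?thesis
      using bij_betw_inv_into_right[OF bY] by (simp add: \<phi>_def)
  qed
  have sub: "cozero X f \<subseteq> X.L" if "f \<in> V_set X P S" for f
    using that bX by (auto simp: bij_betw_def proper_parts_def)
  have mono: "\<sigma> ` A \<subseteq> \<sigma> ` B \<longleftrightarrow> A \<subseteq> B" if "A \<subseteq> X.L" "B \<subseteq> X.L" for A B
    using bij that by (auto simp: bij_betw_def inj_on_image_subset_iff)
  show ?thesis unfolding sgraph_isomorphic_def
  proof (intro exI conjI ballI)
    show "bij_betw \<phi> (sverts (G_graph X P S)) (sverts (G_graph Y Q T))"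
      using b\<phi> by (simp add: X.verts_G_graph Y.verts_G_graph)
  next
    fix f g assume "f \<in> sverts (G_graph X P S)" "g \<in> sverts (G_graph X P S)"
    then have fg: "f \<in> V_set X P S" "g \<in> V_set X P S" by (simp_all add: X.verts_G_graph)
    then have "\<phi> f \<in> V_set Y Q T" "\<phi> g \<in> V_set Y Q T"
      using b\<phi> by (auto simp: bij_betw_def)
    then show "{f, g} \<in> sedges (G_graph X P S) \<longleftrightarrow> {\<phi> f, \<phi> g} \<in> sedges (G_graph Y Q T)"
      using fg by (simp add: X.edge_G_graph_iff[OF S] Y.edge_G_graph_iff[OF T] coz mono sub)
  qed
qed

theorem mainTheorem17:
  fixes X :: "'a topology" and Y :: "'b topology"
    and P :: "'a set set" and Q :: "'b set set"
    and S :: "('a \<Rightarrow> real) set" and T :: "('b \<Rightarrow> real) set"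
  assumes "completely_regular_space X" and "Hausdorff_space X"
    and "completely_regular_space Y" and "Hausdorff_space Y"
    and "closed_ideal X P" and "closed_ideal Y Q"
    and "finite (local_part X P)" and "card (local_part X P) \<ge> 2"
    and "finite (local_part Y Q)" and "card (local_part Y Q) \<ge> 2"
    and "class_representatives X P S" and "class_representatives Y Q T"
  shows "(sgraph_isomorphic (G_graph X P S) (G_graph Y Q T) \<longleftrightarrow>
            sgraph_isomorphic (annihilator_graph (C_ring X P)) (annihilator_graph (C_ring Y Q))) \<and>
         (sgraph_isomorphic (annihilator_graph (C_ring X P)) (annihilator_graph (C_ring Y Q)) \<longleftrightarrow>
            rng_isomorphic (C_ring X P) (C_ring Y Q))"
proof -
  have fX: "finite_local_part X P" and fY: "finite_local_part Y Q"
    using assms by (simp_all add: finite_local_part_def)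
  interpret X: finite_local_part X P by (rule fX)
  interpret Y: finite_local_part Y Q by (rule fY)
  let ?G = "sgraph_isomorphic (G_graph X P S) (G_graph Y Q T)"
  let ?AG = "sgraph_isomorphic (annihilator_graph X.R) (annihilator_graph Y.R)"
  let ?R = "rng_isomorphic X.R Y.R"
  have ne: "X.L \<noteq> {}" "Y.L \<noteq> {}" using assms(8,10) by auto
  have "?R \<Longrightarrow> ?AG"
    by (rule rng_isomorphic_annihilator_graph)
      (simp_all add: comm_rng_C_ring assms(5,6))
  moreover have "card X.L = card Y.L" if "?AG \<or> ?G"
  proof (rule card_eq_from_proper_parts[OF assms(7) ne(1) assms(9) ne(2)])
    show "card (proper_parts X.L) = card (proper_parts Y.L)"
      using that sgraph_isomorphic_card_neighbourhoods sgraph_isomorphic_card_verts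
        X.card_neighbourhoods Y.card_neighbourhoods
        X.card_verts_G_graph[OF assms(11)] Y.card_verts_G_graph[OF assms(12)]
      by metis
  qed
  moreover have "?R \<and> ?G" if card_eq: "card X.L = card Y.L"
  proof -
    obtain \<sigma> where "bij_betw \<sigma> X.L Y.L"
      using finite_same_card_bij[OF assms(7,9) card_eq] by blast
    then show ?thesis
      using rng_isomorphic_of_bij[OF fX fY] G_graph_isomorphic_of_bij[OF fX fY] assms(11,12)
      by blast
  qed
  ultimately show ?thesis by blast
qed

end
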